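(* Let $G$ be a path or an even cycle whose edges are each colored red, blue or yellow, with its edges numbered consecutively $0,1,2,\dots$ (for a path starting from one of its end edges, for a cycle starting from an arbitrary edge). Let $M_0$ and $M_1$ be the matchings consisting of the even-numbered and the odd-numbered edges respectively, and assume $|M_0|\ge|M_1|$. Assume $(k_R,k_B)$ is an integer point on the segment between $p_{M_0}$ and $p_{M_1}$. Then there is a matching $M$ of $G$ with $|M|\ge|M_1|-1$, exactly $k_R$ red edges, and either $k_B$ or $k_B-1$ blue edges. Moreover, such a matching can be found in polynomial time.
   Context: For a set of edges $M$, $p_M=(|R\cap M|,|B\cap M|)\in\mathbb R^2$, where $R$ and $B$ are the sets of red and blue edges. *)

theory Defs
  imports "HOL-Analysis.Analysis" "HOL-Computational_Algebra.Polynomial"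
begin

section \<open>Paths and even cycles with consecutively numbered edges\<close>

text \<open>
  Graphs are finite and simple, given by a vertex set \<open>V\<close> and a set \<open>E\<close> of two-element subsets
  of \<open>V\<close>. The numbering of the edges is the list \<open>es\<close>: edge number \<open>i\<close> is \<open>es ! i\<close>.
  Since the vertex list \<open>vs\<close> is arbitrary, a path may be numbered from either end, and a
  cycle from any edge in either direction. A path may consist of a single vertex.
\<close>

definition path_numbering :: "'v set \<Rightarrow> 'v set set \<Rightarrow> 'v set list \<Rightarrow> bool" where
  "path_numbering V E es \<longleftrightarrow>
     (\<exists>vs. vs \<noteq> [] \<and> distinct vs \<and> V = set vs \<and> E = set es \<and>
        es = map (\<lambda>i. {vs ! i, vs ! Suc i}) [0..<length vs - 1])"

definition even_cycle_numbering :: "'v set \<Rightarrow> 'v set set \<Rightarrow> 'v set list \<Rightarrow> bool" where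
  "even_cycle_numbering V E es \<longleftrightarrow>
     (\<exists>vs. length vs \<ge> 3 \<and> even (length vs) \<and> distinct vs \<and> V = set vs \<and> E = set es \<and>
        es = map (\<lambda>i. {vs ! i, vs ! (Suc i mod length vs)}) [0..<length vs])"

definition matching :: "'v set set \<Rightarrow> 'v set set \<Rightarrow> bool" where
  "matching E M \<longleftrightarrow> M \<subseteq> E \<and> (\<forall>e\<in>M. \<forall>f\<in>M. e \<noteq> f \<longrightarrow> e \<inter> f = {})"

definition even_edges :: "'v set list \<Rightarrow> 'v set set" where
  "even_edges es = {es ! i | i. i < length es \<and> even i}"

definition odd_edges :: "'v set list \<Rightarrow> 'v set set" where
  "odd_edges es = {es ! i | i. i < length es \<and> odd i}"

datatype colour = Red | Blue | Yellow

definition edges_of_colour :: "('v set \<Rightarrow> colour) \<Rightarrow> 'v set set \<Rightarrow> colour \<Rightarrow> 'v set set" where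
  "edges_of_colour col E c = {e \<in> E. col e = c}"

definition colour_point :: "('v set \<Rightarrow> colour) \<Rightarrow> 'v set set \<Rightarrow> 'v set set \<Rightarrow> real \<times> real" where
  "colour_point col E M =
     (real (card (edges_of_colour col E Red \<inter> M)), real (card (edges_of_colour col E Blue \<inter> M)))"

definition admissible_instance ::
    "'v set \<Rightarrow> 'v set set \<Rightarrow> 'v set list \<Rightarrow> ('v set \<Rightarrow> colour) \<Rightarrow> int \<Rightarrow> int \<Rightarrow> bool" where
  "admissible_instance V E es col kR kB \<longleftrightarrow>
     (path_numbering V E es \<or> even_cycle_numbering V E es) \<and>
     card (even_edges es) \<ge> card (odd_edges es) \<and>
     (real_of_int kR, real_of_int kB) \<in>
       closed_segment (colour_point col E (even_edges es)) (colour_point col E (odd_edges es))"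

definition required_matching ::
    "'v set set \<Rightarrow> 'v set list \<Rightarrow> ('v set \<Rightarrow> colour) \<Rightarrow> int \<Rightarrow> int \<Rightarrow> 'v set set \<Rightarrow> bool" where
  "required_matching E es col kR kB M \<longleftrightarrow>
     matching E M \<and>
     int (card M) \<ge> int (card (odd_edges es)) - 1 \<and>
     int (card (edges_of_colour col E Red \<inter> M)) = kR \<and>
     (int (card (edges_of_colour col E Blue \<inter> M)) = kB \<or>
      int (card (edges_of_colour col E Blue \<inter> M)) = kB - 1)"


section \<open>A random access machine with running times\<close>

text \<open>
  Algorithms are structured programs of a random access machine under the uniform cost
  measure. The store consists of arrays of natural numbers, \<open>s a i\<close> being cell \<open>i\<close> of array \<open>a\<close>;
  a program names its arrays statically (so it uses finitely many), whereas indices are computed.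
  A scalar variable is a cell with constant index.

  Every executed assignment and every evaluated test costs one unit; expressions have
  a size fixed by the program. The only arithmetic is addition and truncated subtraction, so the
  bit length of the numbers in the store grows by at most a constant, depending on the program
  only, in each step. Hence time on this machine and time on a Turing machine are polynomially
  related (there would be no such relation with unit-cost multiplication).
\<close>

type_synonym store = "nat \<Rightarrow> nat \<Rightarrow> nat"

datatype aexp = Num nat | Cell nat aexp | Plus aexp aexp | Monus aexp aexp

datatype bexp = Less aexp aexp | Equal aexp aexp | Neg bexp | Conj bexp bexp

datatype com =
    Skip
  | Assign nat aexp aexp \<comment> \<open>\<open>Assign a i e\<close> stores the value of \<open>e\<close> in cell \<open>i\<close> of array \<open>a\<close>\<close>
  | Seq com com
  | If bexp com com
  | While bexp com

fun aval :: "aexp \<Rightarrow> store \<Rightarrow> nat" where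
  "aval (Num n) s = n"
| "aval (Cell a i) s = s a (aval i s)"
| "aval (Plus e f) s = aval e s + aval f s"
| "aval (Monus e f) s = aval e s - aval f s"

fun bval :: "bexp \<Rightarrow> store \<Rightarrow> bool" where
  "bval (Less e f) s \<longleftrightarrow> aval e s < aval f s"
| "bval (Equal e f) s \<longleftrightarrow> aval e s = aval f s"
| "bval (Neg b) s \<longleftrightarrow> \<not> bval b s"
| "bval (Conj b c) s \<longleftrightarrow> bval b s \<and> bval c s"

definition update :: "store \<Rightarrow> nat \<Rightarrow> nat \<Rightarrow> nat \<Rightarrow> store" where
  "update s a i n = s(a := (s a)(i := n))"

text \<open>\<open>exec c s t s'\<close>: started in \<open>s\<close>, program \<open>c\<close> halts in \<open>s'\<close> after \<open>t\<close> time units.\<close>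

inductive exec :: "com \<Rightarrow> store \<Rightarrow> nat \<Rightarrow> store \<Rightarrow> bool" where
  Skip: "exec Skip s 1 s"
| Assign: "exec (Assign a i e) s 1 (update s a (aval i s) (aval e s))"
| Seq: "exec c s t s' \<Longrightarrow> exec d s' t' s'' \<Longrightarrow> exec (Seq c d) s (t + t') s''"
| IfTrue: "bval b s \<Longrightarrow> exec c s t s' \<Longrightarrow> exec (If b c d) s (Suc t) s'"
| IfFalse: "\<not> bval b s \<Longrightarrow> exec d s t s' \<Longrightarrow> exec (If b c d) s (Suc t) s'"
| WhileFalse: "\<not> bval b s \<Longrightarrow> exec (While b c) s 1 s"
| WhileTrue: "bval b s \<Longrightarrow> exec c s t s' \<Longrightarrow> exec (While b c) s' t' s'' \<Longrightarrow>
    exec (While b c) s (Suc (t + t')) s''"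


section \<open>Input and output of the machine\<close>

text \<open>
  For the machine, vertices are natural numbers and the graph is given by the list \<open>uv\<close> of the
  pairs of endpoints of its edges, in the order of the numbering. The two endpoints of an edge
  come in arbitrary order, and the machine is not told whether the graph is a path or a cycle.
\<close>

definition edges_of_pairs :: "(nat \<times> nat) list \<Rightarrow> nat set list" where
  "edges_of_pairs uv = map (\<lambda>(u, v). {u, v}) uv"

fun colour_code :: "colour \<Rightarrow> nat" where
  "colour_code Red = 0"
| "colour_code Blue = 1"
| "colour_code Yellow = 2"

text \<open>
  Array 0 holds the number of edges and the two target numbers; these are coordinates of a point
  on a segment in the nonnegative quadrant, so \<open>nat\<close> loses nothing. Arrays 1 and 2 hold
  the endpoints and array 3 the colours of the edges. All remaining cells are 0.
\<close>

definition input_store :: "(nat \<times> nat) list \<Rightarrow> (nat set \<Rightarrow> colour) \<Rightarrow> int \<Rightarrow> int \<Rightarrow> store" where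
  "input_store uv col kR kB = (\<lambda>a i.
     if a = 0 then
       (if i = 0 then length uv else if i = 1 then nat kR else if i = 2 then nat kB else 0)
     else if i < length uv then
       (if a = 1 then fst (uv ! i)
        else if a = 2 then snd (uv ! i)
        else if a = 3 then colour_code (col (edges_of_pairs uv ! i))
        else 0)
     else 0)"

text \<open>The computed edge set is read off array 4, as a characteristic vector.\<close>

definition output_edges :: "nat set list \<Rightarrow> store \<Rightarrow> nat set set" where
  "output_edges es s = {es ! i | i. i < length es \<and> s 4 i = 1}"

end

theory Submission
  imports Defs
begin

text \<open>
  Close an odd path by a yellow edge, so that the edges form a cycle of length \<open>2 m\<close>. Choosing an even
  vertex \<open>u\<close> and an odd vertex \<open>w\<close>, taking the odd edges from \<open>u\<close> to \<open>w\<close> and the even ones from \<open>w\<close> to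
  \<open>u\<close> gives a matching of size \<open>m - 1\<close>. Moving \<open>u\<close> or \<open>w\<close> by two exchanges one edge for another, so
  its point in the (red, blue) plane makes a step of the triangular lattice. For fixed \<open>u\<close> and moving
  \<open>w\<close> one obtains a lattice curve from near one end of the segment to near the other. If the points
  \<open>(k\<^sub>R, k\<^sub>B)\<close> and \<open>(k\<^sub>R, k\<^sub>B - 1)\<close> are never hit, the signed number of times the curve passes to the right of
  the edge joining them does not change with \<open>u\<close>. But choosing \<open>u\<close> extremal for a linear functional
  constant on the segment puts the whole curve on one side of the segment or on the other, and
  the two choices give different numbers.

  The algorithm tries all \<open>O(n\<^sup>2)\<close> pairs of cuts.
\<close>

section \<open>Crossing numbers of lattice walks\<close>

text \<open>
  Points are (number of red edges, number of blue edges) relative to the target. A step between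
  heights \<open>-1\<close> and \<open>0\<close> is counted, with sign, iff it passes to the right of the two points
  excluded by \<open>hit\<close>.
\<close>

definition crossing :: "int \<Rightarrow> int \<Rightarrow> int \<Rightarrow> int \<Rightarrow> int" where
  "crossing x y x' y' = (if x + x' > 0 then of_bool (y' \<ge> 0) - of_bool (y \<ge> 0) else 0)"

definition hit :: "int \<Rightarrow> int \<Rightarrow> bool" where
  "hit x y \<longleftrightarrow> x = 0 \<and> (y = 0 \<or> y = -1)"

text \<open>The solutions are the contributions of a yellow, a red and a blue edge.\<close>

definition unit_step :: "int \<Rightarrow> int \<Rightarrow> bool" where
  "unit_step r b \<longleftrightarrow> 0 \<le> r \<and> 0 \<le> b \<and> r + b \<le> 1"

text \<open>The zero vector and the six neighbours of the origin in the triangular lattice.\<close>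

definition lattice_step :: "int \<Rightarrow> int \<Rightarrow> bool" where
  "lattice_step a b \<longleftrightarrow> \<bar>a\<bar> \<le> 1 \<and> \<bar>b\<bar> \<le> 1 \<and> \<bar>a + b\<bar> \<le> 1"

lemma lattice_step_diff:
  "unit_step a a' \<Longrightarrow> unit_step b b' \<Longrightarrow> lattice_step (a - b) (a' - b')"
  unfolding unit_step_def lattice_step_def by linarith

text \<open>\<open>crossing\<close> counts passages through the ray going right from the midpoint of
  the two excluded points. Two lattice steps span a parallelogram (possibly degenerate) without
  lattice points other than its corners. It could wind around that midpoint only with the midpoint
  as its centre, but then its short diagonal would join the excluded points.\<close>

lemma crossing_cell:
  assumes "lattice_step a a'" "lattice_step b b'"
    and "\<not> hit x y" "\<not> hit (x + a) (y + a')" "\<not> hit (x + b) (y + b')" "\<not> hit (x + a + b) (y + a' + b')"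
  shows "crossing x y (x + a) (y + a') + crossing (x + a) (y + a') (x + a + b) (y + a' + b')
       = crossing x y (x + b) (y + b') + crossing (x + b) (y + b') (x + a + b) (y + a' + b')"
  using assms unfolding lattice_step_def crossing_def hit_def of_bool_def
  by (smt (verit))

text \<open>As \<open>y \<noteq> 0\<close>, both ends lie on the same side of height
  \<open>-1/2\<close>, so the path does not cross this height or crosses and returns. In the latter
  case the middle point has height \<open>0\<close> or \<open>-1\<close>; its abscissa is nonzero
  and its sign decides the side of both crossings.\<close>

lemma crossing_corner:
  assumes "unit_step a a'" "unit_step b b'" "unit_step c c'" "y \<noteq> 0"
    and "\<not> hit (x - a) (y - a')" "\<not> hit (x - c) (y - c')"
      "\<not> hit (x - a + (b - c)) (y - a' + (b' - c'))"
  shows "crossing (x - a) (y - a') (x - a + (b - c)) (y - a' + (b' - c'))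
       + crossing (x - a + (b - c)) (y - a' + (b' - c')) (x - c) (y - c') = 0"
  using assms unfolding unit_step_def crossing_def hit_def of_bool_def
  by (smt (z3))

text \<open>Both ends have height \<open>y\<close> or \<open>y - 1\<close>, so a crossing forces
  \<open>y = 0\<close>. One end is then \<open>(x, -1)\<close>; it is not hit, hence
  \<open>x > 0\<close>.\<close>

lemma crossing_right:
  assumes "unit_step a a'" "unit_step c c'" "y = 0 \<Longrightarrow> x \<ge> 0"
    and "\<not> hit (x - a) (y - a')" "\<not> hit (x - c) (y - c')"
  shows "crossing (x - a) (y - a') (x - c) (y - c') = of_bool (y - c' \<ge> 0) - of_bool (y - a' \<ge> 0)"
  using assms unfolding unit_step_def crossing_def hit_def of_bool_def
  by (smt (verit))

lemma crossing_left:
  assumes "unit_step a a'" "unit_step c c'" "y = 0 \<Longrightarrow> x \<le> 0"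
    and "\<not> hit (x - a) (y - a')" "\<not> hit (x - c) (y - c')"
  shows "crossing (x - a) (y - a') (x - c) (y - c') = 0"
  using assms unfolding unit_step_def crossing_def hit_def of_bool_def
  by (smt (verit))

section \<open>Alternating sums and the walk of the two cuts\<close>

definition altsum :: "(nat \<Rightarrow> int) \<Rightarrow> nat \<Rightarrow> int" where
  "altsum f n = (\<Sum>t<n. (- 1) ^ t * f t)"

lemma altsum_0 [simp]: "altsum f 0 = 0"
  by (simp add: altsum_def)

lemma altsum_Suc: "altsum f (Suc n) = altsum f n + (if even n then f n else - f n)"
  by (simp add: altsum_def)

lemma altsum_period:
  assumes "\<And>t. f (t + 2 * m) = f t"
  shows "altsum f (t + 2 * m) = altsum f t + altsum f (2 * m)"
  by (induction t) (simp_all add: altsum_Suc assms)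

lemma periodic_attains_max:
  fixes f :: "nat \<Rightarrow> int"
  assumes "m > 0" "\<And>i. f (i + m) = f i"
  shows "\<exists>i. \<forall>j. f j \<le> f i"
proof -
  have *: "f (j + k * m) = f j" for j k
  proof (induction k)
    case (Suc k)
    then show ?case using assms(2)[of "j + k * m"] by (simp add: algebra_simps)
  qed simp
  have mod: "f (j mod m) = f j" for j using *[of "j mod m" "j div m"] by simp
  have "Max (f ` {..<m}) \<in> f ` {..<m}" using assms(1) by (intro Max_in) auto
  then obtain i where i: "Max (f ` {..<m}) = f i" by auto
  have "f j \<le> f i" for j
    unfolding i[symmetric] mod[of j, symmetric] using assms(1) by (intro Max_ge) auto
  then show ?thesis by blast
qed

text \<open>\<open>(x, y)\<close> is the even matching relative to the target; \<open>2 * i\<close>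
  and \<open>2 * j + 1\<close> are the cuts. \<open>collinear\<close> and \<open>between\<close> put
  the target strictly inside a segment that is not horizontal.\<close>

lemma alternating_walk_hits:
  fixes r b :: "nat \<Rightarrow> int"
  assumes unit: "\<And>t. unit_step (r t) (b t)"
    and per: "\<And>t. r (t + 2 * m) = r t" "\<And>t. b (t + 2 * m) = b t"
    and collinear: "x * altsum b (2 * m) = y * altsum r (2 * m)"
    and between: "0 < y \<and> y < altsum b (2 * m) \<or> altsum b (2 * m) < y \<and> y < 0"
  shows "\<exists>i j. i \<le> j \<and> j < i + m \<and>
    hit (x + altsum r (2 * i) - altsum r (2 * j + 1)) (y + altsum b (2 * i) - altsum b (2 * j + 1))"
proof (rule ccontr)
  define vx vy where "vx = altsum r (2 * m)" and "vy = altsum b (2 * m)"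
  define X where "X i j = x + altsum r (2 * i) - altsum r (2 * j + 1)" for i j
  define Y where "Y i j = y + altsum b (2 * i) - altsum b (2 * j + 1)" for i j
  assume "\<not> ?thesis"
  then have nh: "\<not> hit (X i j) (Y i j)" if "i \<le> j" "j < i + m" for i j
    using that by (auto simp: X_def Y_def)
  have "m > 0" using between by (cases m) auto
  have shift: "altsum r (t + 2 * m) = altsum r t + vx" "altsum b (t + 2 * m) = altsum b t + vy" for t
    unfolding vx_def vy_def by (rule altsum_period, rule per)+
  have Xj: "X i (Suc j) = X i j + (r (2*j+1) - r (2*j+2))"
    and Yj: "Y i (Suc j) = Y i j + (b (2*j+1) - b (2*j+2))" for i j
    by (simp_all add: X_def Y_def altsum_Suc)
  have Xi: "X (Suc i) j = X i j + (r (2*i) - r (2*i+1))"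
    and Yi: "Y (Suc i) j = Y i j + (b (2*i) - b (2*i+1))" for i j
    by (simp_all add: X_def Y_def altsum_Suc)
  \<comment> \<open>For \<open>j = i\<close> only edge \<open>2 * i\<close> lies between the cuts:
    the row starts at the even matching without it.\<close>
  have X0: "X i i = x - r (2*i)" and Y0: "Y i i = y - b (2*i)" for i
    by (simp_all add: X_def Y_def altsum_Suc)
  \<comment> \<open>For \<open>j = i + m - 1\<close> only one edge lies outside: the row ends at the
    odd matching without it.\<close>
  have X1: "X i (i+m-1) = (x - vx) - r (2*(i+m-1)+1)"
    and Y1: "Y i (i+m-1) = (y - vy) - b (2*(i+m-1)+1)" for i
  proof -
    have *: "2*i + 2*m = Suc (2*(i+m-1)+1)" using \<open>m > 0\<close> by simp
    have "altsum r (2*i + 2*m) = altsum r (2*(i+m-1)+1) - r (2*(i+m-1)+1)"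
      "altsum b (2*i + 2*m) = altsum b (2*(i+m-1)+1) - b (2*(i+m-1)+1)"
      unfolding * altsum_Suc by simp_all
    then show "X i (i+m-1) = (x - vx) - r (2*(i+m-1)+1)" "Y i (i+m-1) = (y - vy) - b (2*(i+m-1)+1)"
      unfolding X_def Y_def shift by linarith+
  qed
  \<comment> \<open>\<open>W i\<close> counts the crossings of the curve with cut \<open>2 * i\<close> fixed and the other cut moving; it does
    not depend on \<open>i\<close> because the count around every elementary cell and at both ends vanishes.\<close>
  define C where "C i j = crossing (X i j) (Y i j) (X i (Suc j)) (Y i (Suc j))" for i j
  define D where "D i j = crossing (X i j) (Y i j) (X (Suc i) j) (Y (Suc i) j)" for i j
  define W where "W i = (\<Sum>j=i..<i+m-1. C i j)" for i
  \<comment> \<open>The inequality \<open>i < j\<close> is strict because row \<open>Suc i\<close>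
    begins only at \<open>j = Suc i\<close>.\<close>
  have cell: "C i j - C (Suc i) j = D i j - D i (Suc j)" if "i < j" "Suc j < i + m" for i j
  proof -
    have "C i j + D i (Suc j) = D i j + C (Suc i) j"
      using crossing_cell[OF lattice_step_diff[OF unit[of "2*j+1"] unit[of "2*j+2"]]
          lattice_step_diff[OF unit[of "2*i"] unit[of "2*i+1"]], of "X i j" "Y i j"]
        nh[of i j] nh[of i "Suc j"] nh[of "Suc i" j] nh[of "Suc i" "Suc j"] that
      unfolding C_def D_def by (simp add: Xj Yj Xi Yi algebra_simps)
    then show ?thesis by linarith
  qed
  have rows: "(\<Sum>j=Suc i..<Suc i+k. C i j) - (\<Sum>j=Suc i..<Suc i+k. C (Suc i) j)
      = D i (Suc i) - D i (Suc i+k)" if "Suc i + k < i + m" for i k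
    using that
  proof (induction k)
    case (Suc k)
    then show ?case using cell[of i "Suc i + k"] by simp
  qed simp
  \<comment> \<open>Both ends of this path are the even matching minus one edge, so they surround
    \<open>(x, y)\<close> as in \<open>crossing_corner\<close>.\<close>
  have start: "C i i + D i (Suc i) = 0" if "1 < m" for i
    using crossing_corner[OF unit[of "2*i"] unit[of "2*i+1"] unit[of "2*i+2"], of y x]
      nh[of i i] nh[of i "Suc i"] nh[of "Suc i" "Suc i"] that between X0[of "Suc i"] Y0[of "Suc i"]
    unfolding C_def D_def by (auto simp: Xj Yj X0 Y0)
  \<comment> \<open>The same around \<open>(x - vx, y - vy)\<close>, the odd matching; by
    periodicity row \<open>Suc i\<close> ends with edge \<open>2 * i + 1\<close> missing.\<close>
  have stop: "D i (i+m-1) + C (Suc i) (i+m-1) = 0" if "1 < m" for i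
  proof -
    define j where "j = i + m - 1"
    have j: "Suc i + m - 1 = Suc j" "i < j" "Suc j < Suc i + m" using that by (simp_all add: j_def)
    have "r (2 * Suc j + 1) = r (2*i+1)" "b (2 * Suc j + 1) = b (2*i+1)"
      using per(1)[of "2*i+1"] per(2)[of "2*i+1"] that by (simp_all add: j_def algebra_simps)
    then have "X (Suc i) (Suc j) = x - vx - r (2*i+1)" "Y (Suc i) (Suc j) = y - vy - b (2*i+1)"
      using X1[of "Suc i"] Y1[of "Suc i"] unfolding j by simp_all
    moreover have "X i j = x - vx - r (2*j+1)" "Y i j = y - vy - b (2*j+1)"
      using X1[of i] Y1[of i] unfolding j_def by simp_all
    moreover have "\<not> hit (X i j) (Y i j)" "\<not> hit (X (Suc i) j) (Y (Suc i) j)"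
      "\<not> hit (X (Suc i) (Suc j)) (Y (Suc i) (Suc j))" using j nh[of i j] nh[of "Suc i" j] nh[of "Suc i" "Suc j"] by auto
    moreover have "y - vy \<noteq> 0" using between vy_def by auto
    ultimately show ?thesis
      using crossing_corner[OF unit[of "2*j+1"] unit[of "2*i"] unit[of "2*i+1"], of "y-vy" "x-vx"]
      unfolding C_def D_def j_def[symmetric] by (simp only: Xi Yi not_False_eq_True)
  qed
  \<comment> \<open>Row \<open>Suc i\<close> lacks the first step of row \<open>i\<close> and has a
    new last one; the two corners cancel what telescoping leaves. For \<open>m = 1\<close> each row
    is a single point.\<close>
  have "W (Suc i) = W i" for i
  proof (cases "m = 1")
    case False
    with \<open>m > 0\<close> obtain k where m: "m = Suc (Suc k)" by (metis One_nat_def Suc_pred not_gr_zero)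
    have "W i = C i i + (\<Sum>j=Suc i..<Suc i+k. C i j)"
      unfolding W_def m by (simp add: sum.atLeast_Suc_lessThan)
    moreover have "W (Suc i) = (\<Sum>j=Suc i..<Suc i+k. C (Suc i) j) + C (Suc i) (Suc i+k)"
      unfolding W_def m by simp
    moreover have "i + m - 1 = Suc i + k" by (simp add: m)
    ultimately show ?thesis using rows[of i k] start[of i] stop[of i] m by simp
  qed (simp add: W_def)
  then have W_const: "W i = W 0" for i by (induction i) auto

  \<comment> \<open>For extremal \<open>h i\<close> the curve stays on one side of the line through the two end points, so that
    all its crossings are right ones or all are left ones.\<close>
  define h where "h i = vy * altsum r (2*i) - vx * altsum b (2*i)" for i
  have h_per: "h (i + m) = h i" for i
    using shift[of "2*i"] by (simp add: h_def algebra_simps)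
  \<comment> \<open>Removing edge \<open>2 * j + 1\<close> or \<open>2 * j + 2\<close> at
    \<open>(X', Y')\<close> gives two successive points of the row, the situation of
    \<open>crossing_right\<close>.\<close>
  define X' where "X' i j = x + altsum r (2*i) - altsum r (2*j+2)" for i j
  define Y' where "Y' i j = y + altsum b (2*i) - altsum b (2*j+2)" for i j
  have X': "X i j = X' i j - r (2*j+1)" "X i (Suc j) = X' i j - r (2*j+2)"
    and Y': "Y i j = Y' i j - b (2*j+1)" "Y i (Suc j) = Y' i j - b (2*j+2)" for i j
    by (simp_all add: X_def Y_def X'_def Y'_def altsum_Suc)
  \<comment> \<open>By \<open>collinear\<close> the functional vanishes at
    \<open>(x, y)\<close>.\<close>
  have h_diff: "vy * X' i j - vx * Y' i j = h i - h (Suc j)" for i j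
    using collinear by (simp add: X'_def Y'_def h_def vx_def vy_def algebra_simps)
  obtain i1 where i1: "h j \<le> h i1" for j
    using periodic_attains_max[of m h] \<open>m > 0\<close> h_per by blast
  obtain i2 where i2: "h i2 \<le> h j" for j
    using periodic_attains_max[of m "\<lambda>i. - h i"] \<open>m > 0\<close> h_per by auto
  have sides: "Y' i1 j = 0 \<Longrightarrow> vy * X' i1 j \<ge> 0" "Y' i2 j = 0 \<Longrightarrow> vy * X' i2 j \<le> 0" for j
    using h_diff[of i1 j] h_diff[of i2 j] i1[of "Suc j"] i2[of "Suc j"] by auto
  have right: "W i \<noteq> 0" if side: "\<And>j. Y' i j = 0 \<Longrightarrow> X' i j \<ge> 0" for i
  proof -
    have "C i j = of_bool (Y i (Suc j) \<ge> 0) - of_bool (Y i j \<ge> 0)" if "j \<in> {i..<i+m-1}" for j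
    proof -
      have "\<not> hit (X i j) (Y i j)" "\<not> hit (X i (Suc j)) (Y i (Suc j))"
        using nh[of i j] nh[of i "Suc j"] less_diff_conv[of j "i + m" 1] that by simp_all
      then show ?thesis
        using crossing_right[OF unit[of "2*j+1"] unit[of "2*j+2"] side]
        unfolding C_def X'(1)[of i j] Y'(1)[of i j] X'(2)[of i j] Y'(2)[of i j] by blast
    qed
    then have "W i = (\<Sum>j=i..<i+m-1. of_bool (Y i (Suc j) \<ge> 0) - of_bool (Y i j \<ge> 0))"
      unfolding W_def by (intro sum.cong) auto
    also have "\<dots> = of_bool (Y i (i+m-1) \<ge> 0) - of_bool (Y i i \<ge> 0)"
      using \<open>m > 0\<close> by (subst sum_Suc_diff') auto
    \<comment> \<open>By \<open>between\<close> the row starts and ends on different sides of height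
      \<open>-1/2\<close>, even after the loss of a blue edge.\<close>
    also have "\<dots> \<noteq> 0"
      using between unit[of "2*i"] unit[of "2*(i+m-1)+1"]
      unfolding Y0 Y1 unit_step_def vy_def[symmetric] by auto
    finally show ?thesis .
  qed
  have left: "W i = 0" if "\<And>j. Y' i j = 0 \<Longrightarrow> X' i j \<le> 0" for i
    unfolding W_def
  proof (intro sum.neutral ballI)
    fix j assume "j \<in> {i..<i+m-1}"
    then have "\<not> hit (X i j) (Y i j)" "\<not> hit (X i (Suc j)) (Y i (Suc j))"
      using nh[of i j] nh[of i "Suc j"] less_diff_conv[of j "i + m" 1] by simp_all
    then show "C i j = 0"
      using crossing_left[OF unit[of "2*j+1"] unit[of "2*j+2"] that[of j]]
      unfolding C_def X'(1)[of i j] Y'(1)[of i j] X'(2)[of i j] Y'(2)[of i j] by blast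
  qed
  have "vy > 0 \<or> vy < 0" using between vy_def by auto
  then show False
  proof
    assume "vy > 0"
    then have "W i1 \<noteq> 0" "W i2 = 0"
      using sides by (auto intro!: left right simp: zero_le_mult_iff mult_le_0_iff)
    then show False using W_const[of i1] W_const[of i2] by simp
  next
    assume "vy < 0"
    then have "W i2 \<noteq> 0" "W i1 = 0"
      using sides by (auto intro!: left right simp: zero_le_mult_iff mult_le_0_iff)
    then show False using W_const[of i1] W_const[of i2] by simp
  qed
qed

section \<open>Alternating index sets\<close>

text \<open>Adds the horizontal segments to the previous lemma.\<close>

lemma alternating_walk_hits_segment:
  fixes r b :: "nat \<Rightarrow> int" and l :: real
  assumes unit: "\<And>t. unit_step (r t) (b t)"
    and per: "\<And>t. r (t + 2 * m) = r t" "\<And>t. b (t + 2 * m) = b t"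
    and l: "0 < l" "l < 1"
    and x: "real_of_int x = l * real_of_int (altsum r (2 * m))"
    and y: "real_of_int y = l * real_of_int (altsum b (2 * m))"
    and ne: "altsum r (2 * m) \<noteq> 0 \<or> altsum b (2 * m) \<noteq> 0"
  shows "\<exists>i j. i \<le> j \<and> j < i + m \<and>
    hit (x + altsum r (2 * i) - altsum r (2 * j + 1)) (y + altsum b (2 * i) - altsum b (2 * j + 1))"
proof -
  have between: "0 < z \<and> z < v \<or> v < z \<and> z < 0"
    if "real_of_int z = l * real_of_int v" "v \<noteq> 0" for z v :: int
  proof -
    have "0 < v \<or> v < 0" using that(2) by linarith
    then show ?thesis
    proof
      assume "0 < v"
      then have "0 < real_of_int z" "real_of_int z < real_of_int v"
        using l unfolding that(1) by simp_all
      then show ?thesis by simp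
    next
      assume "v < 0"
      then have "real_of_int z < 0" "real_of_int v < real_of_int z"
        using l unfolding that(1) by (simp_all add: mult_pos_neg)
      then show ?thesis by simp
    qed
  qed
  have "real_of_int (x * altsum b (2 * m)) = real_of_int (y * altsum r (2 * m))"
    by (simp add: x y)
  then have collinear: "x * altsum b (2 * m) = y * altsum r (2 * m)" by linarith
  show ?thesis
  proof (cases "altsum b (2 * m) = 0")
    case False
    then show ?thesis
      using alternating_walk_hits[OF unit per collinear] between[OF y] by blast
  next
    case True
    \<comment> \<open>Exchange blue and yellow: losing one more yellow edge amounts to losing one less blue edge.\<close>
    define g where "g t = 1 - r t - b t" for t
    have g: "altsum g k = of_bool (odd k) - altsum r k - altsum b k" for k
      by (induction k) (simp_all add: altsum_Suc g_def)
    have "y = 0" using y True by simp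
    have "\<exists>i j. i \<le> j \<and> j < i + m \<and> hit (x + altsum r (2 * i) - altsum r (2 * j + 1))
        (- x + altsum g (2 * i) - altsum g (2 * j + 1))"
    proof (rule alternating_walk_hits)
      show "unit_step (r t) (g t)" for t
        using unit[of t] by (simp add: unit_step_def g_def)
      show "g (t + 2 * m) = g t" for t by (simp add: g_def per)
      show "x * altsum g (2 * m) = - x * altsum r (2 * m)" by (simp add: g True)
      show "0 < - x \<and> - x < altsum g (2 * m) \<or> altsum g (2 * m) < - x \<and> - x < 0"
        using between[OF x] ne True by (auto simp: g)
    qed (rule per)
    then obtain i j where ij: "i \<le> j" "j < i + m" "hit (x + altsum r (2 * i) - altsum r (2 * j + 1))
        (- x + altsum g (2 * i) - altsum g (2 * j + 1))" by blast
    \<comment> \<open>At abscissa \<open>0\<close> the new height is minus the old one minus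
      \<open>1\<close>, which swaps the heights \<open>0\<close> and \<open>-1\<close>.\<close>
    from ij(3) have "hit (x + altsum r (2 * i) - altsum r (2 * j + 1))
        (y + altsum b (2 * i) - altsum b (2 * j + 1))"
      unfolding hit_def g \<open>y = 0\<close> by simp linarith
    with ij(1,2) show ?thesis by blast
  qed
qed

text \<open>
  The edges of the parity other than that of \<open>a\<close> inside \<open>[a, b)\<close>, those of the parity of \<open>a\<close>
  outside. So \<open>(0, 0)\<close> and \<open>(1, 1)\<close> are the two given matchings, and a window that wraps around the
  cycle is replaced by its complement.
\<close>

definition alt_set :: "nat \<Rightarrow> nat \<Rightarrow> nat \<Rightarrow> nat set" where
  "alt_set n a b = {t. t < n \<and> ((a \<le> t \<and> t < b) \<longleftrightarrow> (odd t \<noteq> odd a))}"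

definition cut_pair :: "nat \<Rightarrow> nat \<Rightarrow> nat \<Rightarrow> bool" where
  "cut_pair n a b \<longleftrightarrow> a \<le> b \<and> b \<le> n \<and> (a = b \<or> odd a \<noteq> odd b)"

lemma finite_alt_set [simp]: "finite (alt_set n a b)"
  by (simp add: alt_set_def)

lemma altsum_parity:
  "altsum f n = (\<Sum>t | t < n \<and> even t. f t) - (\<Sum>t | t < n \<and> odd t. f t)"
proof -
  have "(\<Sum>t | t < n \<and> P t. f t) = (\<Sum>t<n. if P t then f t else 0)" for P
    by (subst sum.inter_filter[symmetric]) (auto intro: sum.cong)
  then show ?thesis
    unfolding altsum_def by (simp add: sum_subtractf[symmetric]) (auto intro: sum.cong)
qed

text \<open>Starting from the parity class of \<open>a\<close>, the window exchanges this class for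
  the other one, which costs the alternating sum over the window up to sign.\<close>

lemma sum_alt_set:
  assumes "a \<le> b" "b \<le> n"
  shows "(\<Sum>t\<in>alt_set n a b. f t)
    = (\<Sum>t | t < n \<and> odd t = odd a. f t) - (- 1) ^ a * (altsum f b - altsum f a)"
proof -
  have sub: "{t. t < n \<and> P t} = {t \<in> {..<n}. P t}" for P by auto
  have "altsum f b - altsum f a = (\<Sum>t\<in>{..<b} - {..<a}. (- 1) ^ t * f t)"
    unfolding altsum_def using assms by (subst sum_diff) auto
  also have "\<dots> = (\<Sum>t | t < n \<and> (a \<le> t \<and> t < b). (- 1) ^ t * f t)"
    using assms by (intro sum.cong) auto
  finally have d: "altsum f b - altsum f a = \<dots>" .
  show ?thesis
    unfolding d alt_set_def sub sum.inter_filter[OF finite_lessThan] sum_distrib_left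
      sum_subtractf[symmetric]
    by (intro sum.cong) auto
qed

text \<open>Moves cuts on the closed cycle to cuts of \<open>0..<N\<close>. With \<open>f\<close>
  quantified inside, one pair serves all colours.\<close>

lemma walk_cut_pair:
  assumes m: "m = (N + 1) div 2" and ij: "i \<le> j" "j < i + m"
  shows "\<exists>a b. cut_pair N a b \<and> (\<forall>f. (\<forall>t. f (t + 2 * m) = f t) \<longrightarrow> (odd N \<longrightarrow> f N = 0) \<longrightarrow>
    (\<Sum>t\<in>alt_set N a b. f t) = (\<Sum>t | t < N \<and> even t. f t) + altsum f (2 * i) - altsum f (2 * j + 1))"
proof -
  \<comment> \<open>Both cuts are shifted by \<open>k\<close> periods, bringing the even one into
    the first period.\<close>
  define k u w where "k = i div m" and "u = i mod m" and "w = j - k * m"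
  have "m > 0" using ij by simp
  then have "u < m" by (simp add: u_def)
  have i: "i = u + k * m" by (simp add: u_def k_def)
  then have j: "j = w + k * m" using ij by (simp add: w_def)
  have uw: "u \<le> w" "w < u + m" using ij unfolding i j by auto
  have two: "2 * m = N \<or> 2 * m = Suc N \<and> odd N" using m by (cases "even N") auto
  have shift: "altsum f (t + 2 * (k' * m)) = altsum f t + int k' * altsum f (2 * m)"
    if "\<forall>t. f (t + 2 * m) = f t" for f t k'
  proof (induction k')
    case (Suc k')
    then show ?case
      using altsum_period[of f m "t + 2 * (k' * m)"] that by (simp add: algebra_simps)
  qed simp
  have diff: "altsum f (2 * i) - altsum f (2 * j + 1) = altsum f (2 * u) - altsum f (2 * w + 1)"
    if "\<forall>t. f (t + 2 * m) = f t" for f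
    using shift[OF that, of "2 * u" k] shift[OF that, of "2 * w + 1" k]
    by (simp add: i j algebra_simps)
  have total: "altsum f (2 * m) = (\<Sum>t | t < N \<and> even t. f t) - (\<Sum>t | t < N \<and> odd t. f t)"
    if "odd N \<longrightarrow> f N = 0" for f
    using two that altsum_parity[of f N] by (auto simp: altsum_Suc)
  show ?thesis
  proof (cases "w < m")
    case True
    have "cut_pair N (2 * u) (2 * w + 1)"
      using uw True two by (auto simp: cut_pair_def)
    moreover have "(\<Sum>t\<in>alt_set N (2 * u) (2 * w + 1). f t)
      = (\<Sum>t | t < N \<and> even t. f t) + altsum f (2 * i) - altsum f (2 * j + 1)"
      if "\<forall>t. f (t + 2 * m) = f t" for f
      using sum_alt_set[of "2 * u" "2 * w + 1" N f] diff[OF that] calculation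
      by (simp add: cut_pair_def)
    ultimately show ?thesis by blast
  next
    case False
    \<comment> \<open>The window wraps around. Its complement starts at the odd cut, so the base
      class changes from even to odd; \<open>total\<close> accounts for the difference.\<close>
    define w' where "w' = w - m"
    have w: "w = w' + m" using False by (simp add: w'_def)
    have "cut_pair N (2 * w' + 1) (2 * u)"
      using uw \<open>u < m\<close> two unfolding w by (auto simp: cut_pair_def)
    moreover have "(\<Sum>t\<in>alt_set N (2 * w' + 1) (2 * u). f t)
      = (\<Sum>t | t < N \<and> even t. f t) + altsum f (2 * i) - altsum f (2 * j + 1)"
      if "\<forall>t. f (t + 2 * m) = f t" "odd N \<longrightarrow> f N = 0" for f
      using sum_alt_set[of "2 * w' + 1" "2 * u" N f] diff[OF that(1)] total[of f] that(2) calculation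
        shift[OF that(1), of "2 * w' + 1" 1]
      by (simp add: cut_pair_def w algebra_simps)
    ultimately show ?thesis by blast
  qed
qed

section \<open>Existence of a good cut\<close>

definition colour_count :: "(nat \<Rightarrow> colour) \<Rightarrow> colour \<Rightarrow> nat set \<Rightarrow> nat" where
  "colour_count c q S = card {t \<in> S. c t = q}"

definition good_cut :: "nat \<Rightarrow> (nat \<Rightarrow> colour) \<Rightarrow> int \<Rightarrow> int \<Rightarrow> nat \<Rightarrow> nat \<Rightarrow> bool" where
  "good_cut n c kR kB a b \<longleftrightarrow> int (colour_count c Red (alt_set n a b)) = kR \<and>
    (int (colour_count c Blue (alt_set n a b)) = kB \<or> int (colour_count c Blue (alt_set n a b)) = kB - 1)"

lemma good_cut_exists:
  assumes seg: "(real_of_int kR, real_of_int kB) \<in> closed_segment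
     (real (colour_count c Red {t. t < N \<and> even t}), real (colour_count c Blue {t. t < N \<and> even t}))
     (real (colour_count c Red {t. t < N \<and> odd t}), real (colour_count c Blue {t. t < N \<and> odd t}))"
  shows "\<exists>a b. cut_pair N a b \<and> good_cut N c kR kB a b"
proof -
  \<comment> \<open>A path with an odd number \<open>N\<close> of edges is closed to a cycle by a yellow edge number \<open>N\<close>.\<close>
  define m where "m = (N + 1) div 2"
  define f :: "colour \<Rightarrow> nat \<Rightarrow> int" where
    "f q t = of_bool (t mod (2 * m) < N \<and> c (t mod (2 * m)) = q)" for q t
  have two: "2 * m = N \<or> 2 * m = Suc N \<and> odd N" by (cases "even N") (auto simp: m_def)
  have per: "f q (t + 2 * m) = f q t" for q t by (simp add: f_def)
  have sup: "odd N \<longrightarrow> f q N = 0" for q using two by (auto simp: f_def)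
  have cnt: "(\<Sum>t\<in>S. f q t) = int (colour_count c q S)" if "S \<subseteq> {..<N}" for q S
  proof -
    have "finite S" using that finite_subset by blast
    have "f q t = (if c t = q then 1 else 0)" if "t \<in> S" for t
    proof -
      have "t < N" "t mod (2 * m) = t" using that \<open>S \<subseteq> {..<N}\<close> two by auto
      then show ?thesis by (simp add: f_def)
    qed
    then have "(\<Sum>t\<in>S. f q t) = (\<Sum>t\<in>S. if c t = q then 1 else 0)" by (intro sum.cong) auto
    also have "\<dots> = int (colour_count c q S)"
      using \<open>finite S\<close> by (simp add: colour_count_def sum.inter_filter[symmetric])
    finally show ?thesis .
  qed
  define Ev Od where "Ev q = int (colour_count c q {t. t < N \<and> even t})"
    and "Od q = int (colour_count c q {t. t < N \<and> odd t})" for q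
  have Ev: "(\<Sum>t | t < N \<and> even t. f q t) = Ev q" for q
    unfolding Ev_def by (rule cnt) auto
  have Od: "(\<Sum>t | t < N \<and> odd t. f q t) = Od q" for q
    unfolding Od_def by (rule cnt) auto
  have v: "altsum (f q) (2 * m) = Ev q - Od q" for q
    using two sup[of q] altsum_parity[of "f q" N] by (auto simp: altsum_Suc Ev Od)
  obtain l :: real where l: "0 \<le> l" "l \<le> 1" and kR: "kR = (1 - l) * Ev Red + l * Od Red"
    and kB: "kB = (1 - l) * Ev Blue + l * Od Blue"
    using seg by (auto simp: in_segment Ev_def Od_def)
  have even_alt: "alt_set N 0 0 = {t. t < N \<and> even t}" by (auto simp: alt_set_def)
  have M0: ?thesis if "kR = Ev Red" "kB = Ev Blue"
    by (rule exI[of _ 0], rule exI[of _ 0]) (use that in \<open>simp add: cut_pair_def good_cut_def even_alt Ev_def\<close>)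
  have M1: ?thesis if "kR = Od Red" "kB = Od Blue"
  \<comment> \<open>Without edges \<open>(1, 1)\<close> is no cut pair, but then both matchings are
    empty.\<close>
  proof (cases "N = 0")
    case True
    then show ?thesis using that M0 by (simp add: Ev_def Od_def)
  next
    case False
    have "alt_set N 1 1 = {t. t < N \<and> odd t}" by (auto simp: alt_set_def)
    then show ?thesis
      by (intro exI[of _ 1]) (use that False in \<open>simp add: cut_pair_def good_cut_def Od_def\<close>)
  qed
  consider "l = 0" | "l = 1" | "Ev Red = Od Red" "Ev Blue = Od Blue"
    | "0 < l" "l < 1" "Ev Red \<noteq> Od Red \<or> Ev Blue \<noteq> Od Blue" using l by fastforce
  then show ?thesis
  proof cases
    case 1
    then show ?thesis using kR kB by (intro M0) simp_all
  next
    case 2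
    then show ?thesis using kR kB by (intro M1) simp_all
  next
    case 3
    then show ?thesis using kR kB by (intro M0) (simp_all add: algebra_simps)
  next
    case 4
    \<comment> \<open>Relative to the target, the even matching sits at \<open>l\<close> times the
      difference of the two end points.\<close>
    have "\<exists>i j. i \<le> j \<and> j < i + m \<and>
      hit (Ev Red - kR + altsum (f Red) (2 * i) - altsum (f Red) (2 * j + 1))
          (Ev Blue - kB + altsum (f Blue) (2 * i) - altsum (f Blue) (2 * j + 1))"
    proof (rule alternating_walk_hits_segment[where l = l])
      show "unit_step (f Red t) (f Blue t)" for t by (auto simp: unit_step_def f_def)
      show "altsum (f Red) (2 * m) \<noteq> 0 \<or> altsum (f Blue) (2 * m) \<noteq> 0" using 4(3) by (simp add: v)
      show "real_of_int (Ev Red - kR) = l * real_of_int (altsum (f Red) (2 * m))"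
        "real_of_int (Ev Blue - kB) = l * real_of_int (altsum (f Blue) (2 * m))"
        unfolding v using kR kB by (simp_all add: algebra_simps)
    qed (use 4 per in auto)
    then obtain i j where ij: "i \<le> j" "j < i + m"
      "hit (Ev Red - kR + altsum (f Red) (2 * i) - altsum (f Red) (2 * j + 1))
          (Ev Blue - kB + altsum (f Blue) (2 * i) - altsum (f Blue) (2 * j + 1))" by blast
    obtain a b where ab: "cut_pair N a b" and sums: "\<And>q. (\<Sum>t\<in>alt_set N a b. f q t)
        = Ev q + altsum (f q) (2 * i) - altsum (f q) (2 * j + 1)"
      using walk_cut_pair[OF m_def ij(1,2)] per sup Ev by metis
    have "alt_set N a b \<subseteq> {..<N}" by (auto simp: alt_set_def)
    then have "good_cut N c kR kB a b"
      using ij(3) sums[of Red] sums[of Blue] by (auto simp: good_cut_def cnt hit_def)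
    with ab show ?thesis by blast
  qed
qed

section \<open>Matchings\<close>

text \<open>A nonempty window has odd length and begins and ends in the class of \<open>a\<close>,
  so the exchange loses exactly one edge.\<close>

lemma card_alt_set_ge:
  assumes "cut_pair n a b"
  shows "n div 2 \<le> Suc (card (alt_set n a b))"
proof -
  have alt: "altsum (\<lambda>_. 1) k = of_bool (odd k)" for k
    by (induction k) (simp_all add: altsum_Suc)
  have halves: "card {t. t < k \<and> even t} = (k + 1) div 2" "card {t. t < k \<and> odd t} = k div 2" for k :: nat
  proof (induction k)
    case (Suc k)
    have "{t. t < Suc k \<and> P t} = (if P k then insert k {t. t < k \<and> P t} else {t. t < k \<and> P t})" for P
      by (auto simp: less_Suc_eq)
    with Suc show "card {t. t < Suc k \<and> even t} = (Suc k + 1) div 2"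
      "card {t. t < Suc k \<and> odd t} = Suc k div 2" by simp_all
  qed simp_all
  have "int (card (alt_set n a b)) = (\<Sum>t\<in>alt_set n a b. 1)" by simp
  also have "\<dots> = int (card {t. t < n \<and> odd t = odd a}) - (- 1) ^ a * (of_bool (odd b) - of_bool (odd a))"
    using assms by (subst sum_alt_set) (auto simp: cut_pair_def alt)
  also have "\<dots> \<ge> int (n div 2) - 1"
    using assms by (cases "even a") (auto simp: cut_pair_def halves)
  finally show ?thesis by linarith
qed

text \<open>Only an upper bound on the adjacencies, so that paths and even cycles satisfy the same
  condition.\<close>

definition consecutive_adjacency :: "'v set list \<Rightarrow> bool" where
  "consecutive_adjacency es \<longleftrightarrow> (\<forall>i j. i < j \<longrightarrow> j < length es \<longrightarrow> es ! i \<inter> es ! j \<noteq> {} \<longrightarrow>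
     j = Suc i \<or> i = 0 \<and> Suc j = length es \<and> even (length es))"

lemma path_numbering_adjacency:
  assumes "path_numbering V E es"
  shows "distinct es" "E = set es" "consecutive_adjacency es"
proof -
  from assms obtain vs where vs: "distinct vs" "E = set es"
    "es = map (\<lambda>i. {vs ! i, vs ! Suc i}) [0..<length vs - 1]"
    by (auto simp: path_numbering_def)
  show "E = set es" by fact
  show "distinct es"
    unfolding vs(3) distinct_map
    by (auto simp: inj_on_def doubleton_eq_iff nth_eq_iff_index_eq[OF vs(1)])
  show "consecutive_adjacency es"
    unfolding consecutive_adjacency_def vs(3)
    by (auto simp: nth_eq_iff_index_eq[OF vs(1)])
qed

lemma even_cycle_numbering_adjacency:
  assumes "even_cycle_numbering V E es"
  shows "distinct es" "E = set es" "consecutive_adjacency es"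
proof -
  from assms obtain vs where vs: "distinct vs" "E = set es" "length vs \<ge> 3" "even (length vs)"
    "es = map (\<lambda>i. {vs ! i, vs ! (Suc i mod length vs)}) [0..<length vs]"
    by (auto simp: even_cycle_numbering_def)
  have nth: "i < length vs \<Longrightarrow> vs ! (Suc i mod length vs) = vs ! (if Suc i = length vs then 0 else Suc i)" for i
    by auto
  have "vs \<noteq> []" using vs(3) by auto
  show "E = set es" by fact
  show "distinct es"
    unfolding vs(5) distinct_map using vs(3) \<open>vs \<noteq> []\<close>
    by (auto simp: inj_on_def doubleton_eq_iff nth nth_eq_iff_index_eq[OF vs(1)] split: if_splits)
  show "consecutive_adjacency es"
    unfolding consecutive_adjacency_def vs(5) using vs(3,4) \<open>vs \<noteq> []\<close>
    by (auto simp: nth nth_eq_iff_index_eq[OF vs(1)] split: if_splits)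
qed

text \<open>Consecutive indices can both be chosen only across a cut. But \<open>a\<close> has the
  base parity and is left out as first index of the window, and \<open>b\<close> has the other
  parity and is left out beyond it.\<close>

lemma alt_set_not_adjacent:
  assumes "cut_pair n a b" "i \<in> alt_set n a b" "j \<in> alt_set n a b" "i < j"
  shows "j \<noteq> Suc i" "\<not> (i = 0 \<and> Suc j = n \<and> even n)"
proof -
  show "j \<noteq> Suc i"
  proof
    assume j: "j = Suc i"
    then have "j = a \<or> j = b"
      using assms by (auto simp: alt_set_def cut_pair_def)
    then show False
      using assms j by (auto simp: alt_set_def cut_pair_def)
  qed
  show "\<not> (i = 0 \<and> Suc j = n \<and> even n)"
  proof
    assume *: "i = 0 \<and> Suc j = n \<and> even n"
    then have "odd j" by auto
    have even: "even a"
    proof (rule ccontr)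
      assume "odd a"
      then show False using * assms(2) by (auto simp: alt_set_def)
    qed
    then have "a \<le> j" "j < b" using assms(3) \<open>odd j\<close> by (auto simp: alt_set_def)
    moreover from this have "b = n" using assms(1) * by (auto simp: cut_pair_def)
    ultimately show False using assms(1) even * by (auto simp: cut_pair_def)
  qed
qed

lemma matching_alt_set:
  assumes "consecutive_adjacency es" "cut_pair (length es) a b"
  shows "matching (set es) ((!) es ` alt_set (length es) a b)"
  unfolding matching_def
proof (intro conjI ballI impI)
  show "(!) es ` alt_set (length es) a b \<subseteq> set es" by (auto simp: alt_set_def)
next
  have disj: "es ! i \<inter> es ! j = {}"
    if "i \<in> alt_set (length es) a b" "j \<in> alt_set (length es) a b" "i < j" for i j
    using assms(1) alt_set_not_adjacent[OF assms(2) that] that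
    unfolding consecutive_adjacency_def alt_set_def by blast
  fix e f assume "e \<in> (!) es ` alt_set (length es) a b" "f \<in> (!) es ` alt_set (length es) a b" "e \<noteq> f"
  then obtain i j where ij: "i \<in> alt_set (length es) a b" "j \<in> alt_set (length es) a b"
    "e = es ! i" "f = es ! j" "i \<noteq> j" by auto
  then show "e \<inter> f = {}" using disj[of i j] disj[of j i] by (cases "i < j") auto
qed

lemma card_edges_of_colour:
  assumes "distinct es" "S \<subseteq> {..<length es}"
  shows "card (edges_of_colour col (set es) q \<inter> (!) es ` S) = colour_count (\<lambda>t. col (es ! t)) q S"
proof -
  have "edges_of_colour col (set es) q \<inter> (!) es ` S = (!) es ` {t \<in> S. col (es ! t) = q}"
    using assms(2) by (auto simp: edges_of_colour_def)
  moreover have "inj_on ((!) es) {t \<in> S. col (es ! t) = q}"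
    using assms by (intro inj_on_nth) auto
  ultimately show ?thesis by (simp add: card_image colour_count_def)
qed

lemma card_odd_edges: "card (odd_edges es) \<le> length es div 2"
proof -
  have "odd_edges es \<subseteq> (\<lambda>t. es ! (2 * t + 1)) ` {..<length es div 2}"
    by (auto simp: odd_edges_def elim!: oddE)
  then have "card (odd_edges es) \<le> card {..<length es div 2}"
    by (rule surj_card_le[rotated]) simp
  then show ?thesis by simp
qed

lemma required_matching_alt_set:
  assumes "distinct es" "consecutive_adjacency es" "cut_pair (length es) a b"
    and "good_cut (length es) (\<lambda>t. col (es ! t)) kR kB a b"
  shows "required_matching (set es) es col kR kB ((!) es ` alt_set (length es) a b)"
proof -
  have sub: "alt_set (length es) a b \<subseteq> {..<length es}" by (auto simp: alt_set_def)
  have "card ((!) es ` alt_set (length es) a b) = card (alt_set (length es) a b)"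
    using assms(1) sub by (intro card_image inj_on_nth) auto
  then show ?thesis
    using matching_alt_set[OF assms(2,3)] card_alt_set_ge[OF assms(3)] card_odd_edges[of es] assms(4)
    by (auto simp: required_matching_def good_cut_def card_edges_of_colour[OF assms(1) sub])
qed

lemma admissible_instance_good_cut:
  assumes "admissible_instance V E es col kR kB"
  shows "distinct es" "E = set es" "consecutive_adjacency es"
    and "\<exists>a b. cut_pair (length es) a b \<and> good_cut (length es) (\<lambda>t. col (es ! t)) kR kB a b"
proof -
  show es: "distinct es" "E = set es" "consecutive_adjacency es"
    using assms path_numbering_adjacency even_cycle_numbering_adjacency
    unfolding admissible_instance_def by blast+
  have eo: "even_edges es = (!) es ` {t. t < length es \<and> even t}"
    "odd_edges es = (!) es ` {t. t < length es \<and> odd t}"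
    by (auto simp: even_edges_def odd_edges_def)
  have point: "colour_point col E ((!) es ` S) = (real (colour_count (\<lambda>t. col (es ! t)) Red S),
      real (colour_count (\<lambda>t. col (es ! t)) Blue S))" if "S \<subseteq> {..<length es}" for S
    unfolding colour_point_def es(2) card_edges_of_colour[OF es(1) that] ..
  have "colour_point col E (even_edges es) = (real (colour_count (\<lambda>t. col (es ! t)) Red {t. t < length es \<and> even t}),
      real (colour_count (\<lambda>t. col (es ! t)) Blue {t. t < length es \<and> even t}))"
    "colour_point col E (odd_edges es) = (real (colour_count (\<lambda>t. col (es ! t)) Red {t. t < length es \<and> odd t}),
      real (colour_count (\<lambda>t. col (es ! t)) Blue {t. t < length es \<and> odd t}))"
    unfolding eo by (auto intro: point)
  then show "\<exists>a b. cut_pair (length es) a b \<and> good_cut (length es) (\<lambda>t. col (es ! t)) kR kB a b"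
    using assms by (intro good_cut_exists) (simp add: admissible_instance_def)
qed

section \<open>The exhaustive search program\<close>

definition runs :: "com \<Rightarrow> store \<Rightarrow> nat \<Rightarrow> (store \<Rightarrow> bool) \<Rightarrow> bool" where
  "runs c s T Q \<longleftrightarrow> (\<exists>t s'. exec c s t s' \<and> t \<le> T \<and> Q s')"

lemma runs_Seq:
  assumes "runs c s T P" "\<And>s'. P s' \<Longrightarrow> runs d s' T' Q"
  shows "runs (Seq c d) s (T + T') Q"
  using assms unfolding runs_def by (meson add_mono exec.Seq)

lemma runs_mono: "runs c s T Q \<Longrightarrow> (\<And>s'. Q s' \<Longrightarrow> Q' s') \<Longrightarrow> runs c s T Q'"
  unfolding runs_def by blast

text \<open>At most \<open>\<mu> s\<close> rounds, each costing the body and a test, and one final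
  test.\<close>

lemma runs_While:
  fixes \<mu> :: "store \<Rightarrow> nat"
  assumes body: "\<And>s. I s \<Longrightarrow> bval b s \<Longrightarrow> runs c s T (\<lambda>s'. I s' \<and> \<mu> s' < \<mu> s)"
    and "I s"
  shows "runs (While b c) s (\<mu> s * Suc T + 1) (\<lambda>s'. I s' \<and> \<not> bval b s')"
  using \<open>I s\<close>
proof (induction "\<mu> s" arbitrary: s rule: less_induct)
  case less
  show ?case
  proof (cases "bval b s")
    case True
    obtain t s' where t: "exec c s t s'" "t \<le> T" "I s'" "\<mu> s' < \<mu> s"
      using body[OF less.prems True] by (auto simp: runs_def)
    obtain t' s'' where t': "exec (While b c) s' t' s''" "t' \<le> \<mu> s' * Suc T + 1" "I s''" "\<not> bval b s''"
      using less.hyps[OF t(4,3)] by (auto simp: runs_def)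
    have "Suc (\<mu> s') * Suc T \<le> \<mu> s * Suc T" using t(4) by (intro mult_right_mono) auto
    then have "Suc (t + t') \<le> \<mu> s * Suc T + 1" using t(2) t'(2) by simp
    then show ?thesis
      unfolding runs_def using exec.WhileTrue[OF True t(1) t'(1)] t'(3,4) by blast
  next
    case False
    then show ?thesis
      unfolding runs_def using exec.WhileFalse[OF False] less.prems by (intro exI[of _ 1] exI[of _ s]) auto
  qed
qed

fun loop_free :: "com \<Rightarrow> bool" where
  "loop_free (Seq c d) \<longleftrightarrow> loop_free c \<and> loop_free d"
| "loop_free (If b c d) \<longleftrightarrow> loop_free c \<and> loop_free d"
| "loop_free (While b c) \<longleftrightarrow> False"
| "loop_free _ \<longleftrightarrow> True"

text \<open>Lets simplification compute the final store of a loop-free program; the value at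
  \<open>While\<close> is a dummy.\<close>

fun effect :: "com \<Rightarrow> store \<Rightarrow> store" where
  "effect (Assign a i e) s = update s a (aval i s) (aval e s)"
| "effect (Seq c d) s = effect d (effect c s)"
| "effect (If b c d) s = (if bval b s then effect c s else effect d s)"
| "effect _ s = s"

fun duration :: "com \<Rightarrow> nat" where
  "duration (Seq c d) = duration c + duration d"
| "duration (If b c d) = Suc (max (duration c) (duration d))"
| "duration _ = 1"

lemma exec_effect: "loop_free c \<Longrightarrow> \<exists>t \<le> duration c. exec c s t (effect c s)"
proof (induction c arbitrary: s)
  case (Seq c d)
  from Seq.prems Seq.IH(1)[of s] Seq.IH(2)[of "effect c s"] show ?case
    by simp (meson add_mono exec.Seq)
next
  case (If b c d)
  show ?case
  proof (cases "bval b s")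
    case True
    from If.prems If.IH(1)[of s] obtain t where "t \<le> duration c" "exec c s t (effect c s)" by auto
    with True show ?thesis by (intro exI[of _ "Suc t"]) (auto intro: exec.IfTrue)
  next
    case False
    from If.prems If.IH(2)[of s] obtain t where "t \<le> duration d" "exec d s t (effect d s)" by auto
    with False show ?thesis by (intro exI[of _ "Suc t"]) (auto intro: exec.IfFalse)
  qed
next
  case (Assign a i e)
  show ?case using exec.Assign[of a i e s] by auto
next
  case Skip
  show ?case using exec.Skip[of s] by auto
qed simp

lemma runs_effect: "loop_free c \<Longrightarrow> Q (effect c s) \<Longrightarrow> runs c s (duration c) Q"
  using exec_effect unfolding runs_def by blast

abbreviation Var :: "nat \<Rightarrow> aexp" where "Var k \<equiv> Cell k (Num 0)"

abbreviation assign :: "nat \<Rightarrow> aexp \<Rightarrow> com" where "assign k e \<equiv> Assign k (Num 0) e"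

abbreviation Disj :: "bexp \<Rightarrow> bexp \<Rightarrow> bexp" where
  "Disj b c \<equiv> Neg (Conj (Neg b) (Neg c))"

text \<open>
  Scalars are cells \<open>0\<close> of arrays: 5 and 6 hold the candidate pair \<open>(a, b)\<close>, 7 the parity of \<open>a\<close>, 8 the
  success flag, 9 the scanned edge, 10 its parity, 11 and 12 the red and blue counts.
\<close>

definition in_window :: bexp where
  "in_window = Conj (Neg (Less (Var 9) (Var 5))) (Less (Var 9) (Var 6))"

definition same_parity :: bexp where
  "same_parity = Equal (Var 10) (Var 7)"

text \<open>Zeros are written too, since array 4 may hold an earlier candidate. The parity is
  toggled because the machine has no division.\<close>

definition scan_step :: com where
  "scan_step =
    Seq (If (Disj (Conj in_window (Neg same_parity)) (Conj (Neg in_window) same_parity))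
           (Seq (Assign 4 (Var 9) (Num 1))
                (If (Equal (Cell 3 (Var 9)) (Num 0)) (assign 11 (Plus (Var 11) (Num 1)))
                   (If (Equal (Cell 3 (Var 9)) (Num 1)) (assign 12 (Plus (Var 12) (Num 1))) Skip)))
           (Assign 4 (Var 9) (Num 0)))
        (Seq (assign 10 (Monus (Num 1) (Var 10))) (assign 9 (Plus (Var 9) (Num 1))))"

definition scan_init :: com where
  "scan_init = Seq (Seq (assign 9 (Num 0)) (assign 10 (Num 0))) (Seq (assign 11 (Num 0)) (assign 12 (Num 0)))"

definition scan_loop :: com where
  "scan_loop = While (Less (Var 9) (Var 0)) scan_step"

text \<open>On failure it moves to the lexicographically next cut pair: after \<open>b = a\<close>
  the parity of \<open>b\<close> has to change, afterwards it has to stay.\<close>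

definition decide :: com where
  "decide =
    If (Conj (Equal (Var 11) (Cell 0 (Num 1)))
          (Disj (Equal (Var 12) (Cell 0 (Num 2))) (Equal (Plus (Var 12) (Num 1)) (Cell 0 (Num 2)))))
      (assign 8 (Num 1))
      (Seq (If (Equal (Var 5) (Var 6)) (assign 6 (Plus (Var 6) (Num 1))) (assign 6 (Plus (Var 6) (Num 2))))
           (If (Less (Var 0) (Var 6))
              (Seq (assign 5 (Plus (Var 5) (Num 1)))
                   (Seq (assign 6 (Var 5)) (assign 7 (Monus (Num 1) (Var 7))))) Skip))"

text \<open>There is no exit on exhaustion: termination rests on the existence of a good
  cut.\<close>

definition search :: com where
  "search = While (Equal (Var 8) (Num 0)) (Seq scan_init (Seq scan_loop decide))"

section \<open>Correctness and running time of the search\<close>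

definition search_state :: "nat \<Rightarrow> (nat \<Rightarrow> colour) \<Rightarrow> int \<Rightarrow> int \<Rightarrow> nat \<Rightarrow> nat \<Rightarrow> store \<Rightarrow> bool" where
  "search_state n c kR kB a b s \<longleftrightarrow>
     s 0 0 = n \<and> s 0 1 = nat kR \<and> s 0 2 = nat kB \<and> (\<forall>i<n. s 3 i = colour_code (c i)) \<and>
     s 5 0 = a \<and> s 6 0 = b \<and> s 7 0 = of_bool (odd a)"

definition scan_state :: "nat \<Rightarrow> (nat \<Rightarrow> colour) \<Rightarrow> nat \<Rightarrow> nat \<Rightarrow> nat \<Rightarrow> store \<Rightarrow> bool" where
  "scan_state n c a b t s \<longleftrightarrow>
     t \<le> n \<and> s 9 0 = t \<and> s 10 0 = of_bool (odd t) \<and>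
     s 11 0 = colour_count c Red (alt_set n a b \<inter> {..<t}) \<and>
     s 12 0 = colour_count c Blue (alt_set n a b \<inter> {..<t}) \<and>
     (\<forall>i<t. s 4 i = of_bool (i \<in> alt_set n a b))"

lemma colour_count_Suc:
  "colour_count c q (S \<inter> {..<Suc t}) = colour_count c q (S \<inter> {..<t}) + of_bool (t \<in> S \<and> c t = q)"
proof -
  have "{x \<in> S \<inter> {..<Suc t}. c x = q}
      = (if t \<in> S \<and> c t = q then insert t {x \<in> S \<inter> {..<t}. c x = q} else {x \<in> S \<inter> {..<t}. c x = q})"
    by (auto simp: less_Suc_eq)
  then show ?thesis by (simp add: colour_count_def)
qed

lemma colour_code_eq [simp]:
  "colour_code q = 0 \<longleftrightarrow> q = Red" "colour_code q = Suc 0 \<longleftrightarrow> q = Blue"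
  by (cases q; simp)+

lemma scan_step_effect:
  assumes "search_state n c kR kB a b s" "scan_state n c a b t s" "t < n"
  shows "search_state n c kR kB a b (effect scan_step s) \<and> scan_state n c a b (Suc t) (effect scan_step s)
    \<and> effect scan_step s 8 0 = s 8 0"
proof -
  have mem: "t \<in> alt_set n a b \<longleftrightarrow> ((a \<le> t \<and> t < b) \<longleftrightarrow> (odd t \<noteq> odd a))"
    using assms(3) by (simp add: alt_set_def)
  have st: "s 0 0 = n" "s 3 t = colour_code (c t)" "s 5 0 = a" "s 6 0 = b" "s 7 0 = of_bool (odd a)"
    "s 9 0 = t" "s 10 0 = of_bool (odd t)"
    using assms by (auto simp: search_state_def scan_state_def)
  have test: "bval (Disj (Conj in_window (Neg same_parity)) (Conj (Neg in_window) same_parity)) s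
      \<longleftrightarrow> t \<in> alt_set n a b"
    unfolding mem by (auto simp: in_window_def same_parity_def st)
  have "effect scan_step s k = s k" if "k \<notin> {4, 9, 10, 11, 12}" for k
    using that by (simp add: scan_step_def update_def)
  moreover have "effect scan_step s 9 0 = Suc t" "effect scan_step s 10 0 = of_bool (odd (Suc t))"
    by (simp_all add: scan_step_def update_def st)
  moreover have "effect scan_step s 11 0 = s 11 0 + of_bool (t \<in> alt_set n a b \<and> c t = Red)"
    "effect scan_step s 12 0 = s 12 0 + of_bool (t \<in> alt_set n a b \<and> c t = Blue)"
    "effect scan_step s 4 = (s 4)(t := of_bool (t \<in> alt_set n a b))"
    unfolding scan_step_def effect.simps test
    by (simp_all add: update_def st)
  ultimately show ?thesis
    using assms unfolding search_state_def scan_state_def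
    by (auto simp: colour_count_Suc less_Suc_eq)
qed

lemma runs_scan_loop:
  assumes "search_state n c kR kB a b s" "scan_state n c a b 0 s" "s 8 0 = 0"
  shows "runs scan_loop s (n * Suc (duration scan_step) + 1)
    (\<lambda>s'. search_state n c kR kB a b s' \<and> scan_state n c a b n s' \<and> s' 8 0 = 0)"
proof -
  define I where "I s \<longleftrightarrow> search_state n c kR kB a b s \<and> scan_state n c a b (s 9 0) s \<and> s 8 0 = 0" for s
  have s0: "s 9 0 = 0" using assms(2) by (simp add: scan_state_def)
  have loop: "runs (While (Less (Var 9) (Var 0)) scan_step) s ((n - s 9 0) * Suc (duration scan_step) + 1)
    (\<lambda>s'. I s' \<and> \<not> bval (Less (Var 9) (Var 0)) s')"
  proof (rule runs_While[where \<mu> = "\<lambda>s. n - s 9 0"])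
    fix s assume I: "I s" and b: "bval (Less (Var 9) (Var 0)) s"
    then have lt: "s 9 0 < n" by (simp add: I_def search_state_def)
    have e: "search_state n c kR kB a b (effect scan_step s)"
      "scan_state n c a b (Suc (s 9 0)) (effect scan_step s)" "effect scan_step s 8 0 = 0"
      using scan_step_effect[of n c kR kB a b s "s 9 0"] I lt by (auto simp: I_def)
    then have "effect scan_step s 9 0 = Suc (s 9 0)" by (simp add: scan_state_def)
    with e lt show "runs scan_step s (duration scan_step) (\<lambda>s'. I s' \<and> n - s' 9 0 < n - s 9 0)"
      by (intro runs_effect) (auto simp: I_def scan_step_def)
  qed (use assms s0 in \<open>simp add: I_def\<close>)
  have "search_state n c kR kB a b s' \<and> scan_state n c a b n s' \<and> s' 8 0 = 0"
    if "I s' \<and> \<not> bval (Less (Var 9) (Var 0)) s'" for s'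
  proof -
    have "s' 9 0 = n" using that by (auto simp: I_def search_state_def scan_state_def)
    with that show ?thesis by (simp add: I_def)
  qed
  then show ?thesis
    unfolding scan_loop_def s0 by (intro runs_mono[OF loop[unfolded s0 diff_zero]])
qed

lemma runs_body:
  assumes s: "search_state n c kR kB a b s" "s 8 0 = 0" and k: "kR \<ge> 0" "kB \<ge> 0"
  shows "runs (Seq scan_init (Seq scan_loop decide)) s
    (duration scan_init + (n * Suc (duration scan_step) + 1 + duration decide))
    (\<lambda>s'. if good_cut n c kR kB a b
       then search_state n c kR kB a b s' \<and> s' 8 0 = 1 \<and> (\<forall>i<n. s' 4 i = of_bool (i \<in> alt_set n a b))
       else s' 8 0 = 0 \<and> (let b' = if a = b then b + 1 else b + 2 in
         if b' \<le> n then search_state n c kR kB a b' s' else search_state n c kR kB (a + 1) (a + 1) s'))"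
proof (rule runs_Seq)
  show "runs scan_init s (duration scan_init)
      (\<lambda>s'. search_state n c kR kB a b s' \<and> scan_state n c a b 0 s' \<and> s' 8 0 = 0)"
    using s by (intro runs_effect)
      (auto simp: scan_init_def update_def search_state_def scan_state_def colour_count_def)
  fix s1 assume "search_state n c kR kB a b s1 \<and> scan_state n c a b 0 s1 \<and> s1 8 0 = 0"
  then have s1: "search_state n c kR kB a b s1" "scan_state n c a b 0 s1" "s1 8 0 = 0" by auto
  show "runs (Seq scan_loop decide) s1 (n * Suc (duration scan_step) + 1 + duration decide)
    (\<lambda>s'. if good_cut n c kR kB a b
       then search_state n c kR kB a b s' \<and> s' 8 0 = 1 \<and> (\<forall>i<n. s' 4 i = of_bool (i \<in> alt_set n a b))
       else s' 8 0 = 0 \<and> (let b' = if a = b then b + 1 else b + 2 in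
         if b' \<le> n then search_state n c kR kB a b' s' else search_state n c kR kB (a + 1) (a + 1) s'))"
  proof (rule runs_Seq[OF runs_scan_loop[OF s1]], rule runs_effect)
    show "loop_free decide" by (simp add: decide_def)
    fix s2 assume s2: "search_state n c kR kB a b s2 \<and> scan_state n c a b n s2 \<and> s2 8 0 = 0"
    have "alt_set n a b \<inter> {..<n} = alt_set n a b" by (auto simp: alt_set_def)
    with s2 have v: "s2 0 0 = n" "s2 0 (Suc 0) = nat kR" "s2 0 2 = nat kB" "s2 5 0 = a" "s2 6 0 = b" "s2 8 0 = 0"
      "s2 7 0 = of_bool (odd a)" "s2 11 0 = colour_count c Red (alt_set n a b)"
      "s2 12 0 = colour_count c Blue (alt_set n a b)"
      by (auto simp: search_state_def scan_state_def)
    \<comment> \<open>For nonnegative targets the conversion by \<open>nat\<close> is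
      faithful.\<close>
    have test: "bval (Conj (Equal (Var 11) (Cell 0 (Num 1)))
          (Disj (Equal (Var 12) (Cell 0 (Num 2))) (Equal (Plus (Var 12) (Num 1)) (Cell 0 (Num 2))))) s2
      \<longleftrightarrow> good_cut n c kR kB a b"
      using k by (auto simp: v good_cut_def)
    show "if good_cut n c kR kB a b
       then search_state n c kR kB a b (effect decide s2) \<and> effect decide s2 8 0 = 1 \<and>
         (\<forall>i<n. effect decide s2 4 i = of_bool (i \<in> alt_set n a b))
       else effect decide s2 8 0 = 0 \<and> (let b' = if a = b then b + 1 else b + 2 in
         if b' \<le> n then search_state n c kR kB a b' (effect decide s2)
         else search_state n c kR kB (a + 1) (a + 1) (effect decide s2))"
      unfolding decide_def effect.simps test
      using s2 by (auto simp: v update_def search_state_def scan_state_def Let_def)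
  qed
qed

text \<open>No later pair is skipped: for fixed \<open>a\<close>, all \<open>b\<close> other than
  \<open>a\<close> share one parity.\<close>

lemma cut_pair_next:
  assumes "cut_pair n a b" "cut_pair n a' b'" "a < a' \<or> a = a' \<and> b \<le> b'" "(a, b) \<noteq> (a', b')"
    and "d = (if a = b then b + 1 else b + 2)"
  shows "if d \<le> n then cut_pair n a d \<and> (a < a' \<or> a = a' \<and> d \<le> b')
    else cut_pair n (a + 1) (a + 1) \<and> (a + 1 < a' \<or> a + 1 = a' \<and> a + 1 \<le> b')"
proof -
  have step: "b + 2 \<le> b'" if "a = a'" "a \<noteq> b"
  proof -
    have "b < b'" using assms(3,4) that by auto
    moreover have "odd b = odd b'" using assms(1,2) that \<open>b < b'\<close> by (auto simp: cut_pair_def)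
    ultimately show ?thesis by (metis Suc_leI add_2_eq_Suc' even_Suc le_neq_implies_less)
  qed
  show ?thesis
    using assms step by (auto simp: cut_pair_def)
qed

lemma runs_search:
  assumes start: "search_state n c kR kB 0 0 s" "s 8 0 = 0"
    and ex: "\<exists>a b. cut_pair n a b \<and> good_cut n c kR kB a b"
  shows "runs search s ((n + 1) ^ 2 *
      Suc (duration scan_init + (n * Suc (duration scan_step) + 1 + duration decide)) + 1)
    (\<lambda>s'. \<exists>a b. cut_pair n a b \<and> good_cut n c kR kB a b \<and> (\<forall>i<n. s' 4 i = of_bool (i \<in> alt_set n a b)))"
proof -
  \<comment> \<open>Some good pair has not yet been passed.\<close>
  define after where "after a b \<longleftrightarrow>
    (\<exists>a' b'. cut_pair n a' b' \<and> good_cut n c kR kB a' b' \<and> (a < a' \<or> a = a' \<and> b \<le> b'))" for a b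
  define I where "I s \<longleftrightarrow> (\<exists>a b. cut_pair n a b \<and> search_state n c kR kB a b s \<and>
    (if s 8 0 = 0 then after a b
     else good_cut n c kR kB a b \<and> (\<forall>i<n. s 4 i = of_bool (i \<in> alt_set n a b))))" for s :: store
  \<comment> \<open>Lexicographic rank from the end; the weight \<open>n + 1\<close> exceeds every
    \<open>n - b\<close>, and \<open>Suc\<close> reserves \<open>0\<close> for success. At
    \<open>(0, 0)\<close> it is \<open>(n + 1) ^ 2\<close>.\<close>
  define \<mu> where "\<mu> s = (if s 8 0 = 0 then Suc ((n - s 5 0) * (n + 1) + (n - s 6 0)) else 0)" for s :: store
  let ?T = "duration scan_init + (n * Suc (duration scan_step) + 1 + duration decide)"
  \<comment> \<open>Targets met by actual counts are nonnegative.\<close>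
  have k: "kR \<ge> 0" "kB \<ge> 0" using ex by (auto simp: good_cut_def)
  have loop: "runs search s (\<mu> s * Suc ?T + 1) (\<lambda>s'. I s' \<and> \<not> bval (Equal (Var 8) (Num 0)) s')"
    unfolding search_def
  proof (rule runs_While)
    fix s assume "I s" "bval (Equal (Var 8) (Num 0)) s"
    then obtain a b where ab: "cut_pair n a b" "search_state n c kR kB a b s" "s 8 0 = 0" "after a b"
      by (auto simp: I_def)
    have \<mu>: "\<mu> s = Suc ((n - a) * (n + 1) + (n - b))" using ab by (simp add: \<mu>_def search_state_def)
    define d where "d = (if a = b then b + 1 else b + 2)"
    have fin: "I s' \<and> \<mu> s' < \<mu> s" if "if good_cut n c kR kB a b
       then search_state n c kR kB a b s' \<and> s' 8 0 = 1 \<and> (\<forall>i<n. s' 4 i = of_bool (i \<in> alt_set n a b))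
       else s' 8 0 = 0 \<and> (let b' = if a = b then b + 1 else b + 2 in
         if b' \<le> n then search_state n c kR kB a b' s' else search_state n c kR kB (a + 1) (a + 1) s')" for s'
    proof (cases "good_cut n c kR kB a b")
      case True
      then have "I s'" "\<mu> s' = 0" using that ab(1) by (auto simp: I_def \<mu>_def)
      then show ?thesis by (simp add: \<mu>)
    next
      case False
      with ab(4) obtain a' b' where a': "cut_pair n a' b'" "good_cut n c kR kB a' b'"
        "a < a' \<or> a = a' \<and> b \<le> b'" "(a, b) \<noteq> (a', b')" by (auto simp: after_def)
      note nxt = cut_pair_next[OF ab(1) a'(1,3,4) d_def]
      from False that have s': "s' 8 0 = 0"
        "if d \<le> n then search_state n c kR kB a d s' else search_state n c kR kB (a + 1) (a + 1) s'"
        by (auto simp: d_def Let_def)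
      show ?thesis
      proof (cases "d \<le> n")
        case True
        then have "I s'"
          using nxt s' a' unfolding I_def after_def by auto
        moreover have "\<mu> s' = Suc ((n - a) * (n + 1) + (n - d))"
          using s' True by (simp add: \<mu>_def search_state_def)
        moreover have "b < d" by (simp add: d_def)
        ultimately show ?thesis using True by (simp add: \<mu>)
      next
        case d: False
        then have "I s'"
          using nxt s' a' unfolding I_def after_def by auto
        moreover have "\<mu> s' = Suc ((n - Suc a) * (n + 1) + (n - Suc a))"
          using s' d by (simp add: \<mu>_def search_state_def)
        moreover have "n - a = Suc (n - Suc a)" using nxt d by (auto simp: cut_pair_def)
        ultimately show ?thesis by (simp add: \<mu>)
      qed
    qed
    from runs_body[OF ab(2,3) k] show "runs (Seq scan_init (Seq scan_loop decide)) s ?T (\<lambda>s'. I s' \<and> \<mu> s' < \<mu> s)"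
      unfolding runs_def using fin by blast
  next
    show "I s"
      unfolding I_def after_def using start ex by (intro exI[of _ 0]) (auto simp: cut_pair_def)
  qed
  have \<mu>: "\<mu> s = (n + 1) ^ 2"
    using start by (simp add: \<mu>_def search_state_def power2_eq_square)
  have "\<exists>a b. cut_pair n a b \<and> good_cut n c kR kB a b \<and> (\<forall>i<n. s' 4 i = of_bool (i \<in> alt_set n a b))"
    if "I s' \<and> \<not> bval (Equal (Var 8) (Num 0)) s'" for s'
  proof -
    have "s' 8 0 \<noteq> 0" using that by simp
    with that show ?thesis unfolding I_def by (metis (no_types, lifting))
  qed
  then show ?thesis by (intro runs_mono[OF loop[unfolded \<mu>]])
qed

lemma search_state_input_store:
  "search_state (length uv) (\<lambda>t. col (edges_of_pairs uv ! t)) kR kB 0 0 (input_store uv col kR kB)"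
  by (simp add: search_state_def input_store_def)

lemma output_edges_alt_set:
  assumes "\<forall>i<length es. s 4 i = of_bool (i \<in> alt_set (length es) a b)"
  shows "output_edges es s = (!) es ` alt_set (length es) a b"
proof -
  have "i < length es" if "i \<in> alt_set (length es) a b" for i
    using that by (simp add: alt_set_def)
  with assms have "{i. i < length es \<and> s 4 i = 1} = alt_set (length es) a b"
    by (auto simp: of_bool_def split: if_splits)
  then show ?thesis unfolding output_edges_def by blast
qed

lemma search_time_polynomial:
  "\<exists>p :: nat poly. \<forall>n. (n + 1) ^ 2 *
      Suc (duration scan_init + (n * Suc (duration scan_step) + 1 + duration decide)) + 1 \<le> poly p n"
proof -
  \<comment> \<open>\<open>K * (n + 1)\<close> bounds the cost of one round; the final
    \<open>1\<close> is absorbed by one more \<open>(n + 1) ^ 3\<close>.\<close>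
  define K where "K = duration scan_init + duration scan_step + duration decide + 3"
  have "(n + 1) ^ 2 * Suc (duration scan_init + (n * Suc (duration scan_step) + 1 + duration decide)) + 1
      \<le> poly (smult (K + 1) ([:1, 1:] ^ 3)) n" for n :: nat
  proof -
    have "Suc (duration scan_init + (n * Suc (duration scan_step) + 1 + duration decide)) \<le> K * (n + 1)"
      by (simp add: K_def algebra_simps)
    then have "(n + 1) ^ 2 * Suc (duration scan_init + (n * Suc (duration scan_step) + 1 + duration decide))
        \<le> (n + 1) ^ 2 * (K * (n + 1))" by (rule mult_left_mono) simp
    also have "x ^ 2 * (K * x) = K * x ^ 3" for x by (simp add: power2_eq_square power3_eq_cube)
    finally have "(n + 1) ^ 2 * Suc (duration scan_init + (n * Suc (duration scan_step) + 1 + duration decide)) + 1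
        \<le> K * (n + 1) ^ 3 + (n + 1) ^ 3" using one_le_power[of "n + 1" 3] by linarith
    also have "\<dots> = poly (smult (K + 1) ([:1, 1:] ^ 3)) n"
      by (simp add: poly_power add.commute)
    finally show ?thesis .
  qed
  then show ?thesis by blast
qed

theorem theorem2p1:
  shows "(\<forall>(V :: 'v set) E es col kR kB.
            admissible_instance V E es col kR kB \<longrightarrow>
            (\<exists>M. required_matching E es col kR kB M)) \<and>
         (\<exists>(prog :: com) (p :: nat poly).
            \<forall>(V :: nat set) E uv col kR kB.
              admissible_instance V E (edges_of_pairs uv) col kR kB \<longrightarrow>
              (\<exists>t s. exec prog (input_store uv col kR kB) t s \<and>
                     t \<le> poly p (length uv) \<and>
                     required_matching E (edges_of_pairs uv) col kR kB
                       (output_edges (edges_of_pairs uv) s)))"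
proof (intro conjI allI impI)
  fix V :: "'v set" and E es col kR kB
  assume "admissible_instance V E es col kR kB"
  from admissible_instance_good_cut[OF this] show "\<exists>M. required_matching E es col kR kB M"
    using required_matching_alt_set by blast
next
  obtain p :: "nat poly" where p: "(n + 1) ^ 2 *
      Suc (duration scan_init + (n * Suc (duration scan_step) + 1 + duration decide)) + 1 \<le> poly p n" for n
    using search_time_polynomial by blast
  have "\<exists>t s. exec search (input_store uv col kR kB) t s \<and> t \<le> poly p (length uv) \<and>
      required_matching E (edges_of_pairs uv) col kR kB (output_edges (edges_of_pairs uv) s)"
    if adm: "admissible_instance V E (edges_of_pairs uv) col kR kB" for V E uv col kR kB
  proof -
    let ?es = "edges_of_pairs uv"
    have len: "length uv = length ?es" by (simp add: edges_of_pairs_def)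
    have "input_store uv col kR kB 8 0 = 0" by (simp add: input_store_def)
    note search = runs_search[OF search_state_input_store this]
    obtain t s a b where t: "exec search (input_store uv col kR kB) t s" "t \<le> poly p (length uv)"
      and ab: "cut_pair (length ?es) a b" "good_cut (length ?es) (\<lambda>t. col (?es ! t)) kR kB a b"
        "\<forall>i<length ?es. s 4 i = of_bool (i \<in> alt_set (length ?es) a b)"
      using search admissible_instance_good_cut(4)[OF adm] order_trans[OF _ p[of "length uv"]]
      unfolding runs_def len[symmetric] by blast
    have "required_matching E ?es col kR kB (output_edges ?es s)"
      unfolding output_edges_alt_set[of ?es s a b, OF ab(3)] admissible_instance_good_cut(2)[OF adm]
      using required_matching_alt_set[OF admissible_instance_good_cut(1,3)[OF adm] ab(1,2)] .
    with t show ?thesis by blast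
  qed
  then show "\<exists>(prog :: com) (p :: nat poly). \<forall>(V :: nat set) E uv col kR kB.
      admissible_instance V E (edges_of_pairs uv) col kR kB \<longrightarrow>
      (\<exists>t s. exec prog (input_store uv col kR kB) t s \<and> t \<le> poly p (length uv) \<and>
         required_matching E (edges_of_pairs uv) col kR kB (output_edges (edges_of_pairs uv) s))"
    by blast
qed

end
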